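(* Let $u$ be a lattice uniformity on a distributive lattice $L$. Then: (i) $(u^* )^*=u^*$. (ii) $u^*$ is the weakest lattice uniformity on $L$ which agrees with $u$ on every order bounded subset of $L$. (iii) The $u^*$-topology is the weakest lattice topology on $L$ which agrees with the $u$-topology on every order bounded subset of $L$.
   Context: A lattice uniformity on a lattice $L$ is a (not necessarily Hausdorff) uniformity on $L$ making $\vee$ and $\wedge$ uniformly continuous as maps $L\times L\to L$. The $u$-topology is the topology induced by $u$. A lattice topology on $L$ is a topology making $\vee$ and $\wedge$ continuous. Uniformities are regarded as filters of entourages; $v\subseteq u$ means $v$ is coarser (weaker) than $u$, and "weakest" means being coarser than every other object with the stated property. Two uniformities (topologies) agree on a subset $B\subseteq L$ if they induce the same uniformity (topology) on $B$. A subset is order bounded if it is contained in some interval $[a,b]:=\{x\in L:a\le x\le b\}$. For $a,b\in L$ let $f_{a,b}:L\to L$, $f_{a,b}(x):=(x\wedge b)\vee a$. Let $J(L):=\{(a,b)\in L^2:a\le b\}$. For a lattice uniformity $u$ on the distributive lattice $L$, $u^*$ is the initial uniformity of the family of maps $f_{a,b}:L\to(L,u)$, $(a,b)\in J(L)$, i.e. the uniformity with subbase consisting of the sets $\{(x,y)\in L^2:(f_{a,b}(x),f_{a,b}(y))\in U\}$ with $(a,b)\in J(L)$, $U\in u$. It is again a lattice uniformity. *)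

theory Defs
  imports "HOL-Analysis.Product_Topology"
begin

text \<open>
  A uniformity on the type \<open>'a\<close> is a filter on \<open>'a \<times> 'a\<close>, whose entourages are the sets
  \<open>{p. E p}\<close> with \<open>eventually E u\<close>. The axioms are those of the class \<open>uniform_space\<close>; that class
  cannot be used itself, because several uniformities on one lattice have to be compared.
\<close>

definition is_uniformity :: "('a \<times> 'a) filter \<Rightarrow> bool" where
  "is_uniformity u \<longleftrightarrow>
     (\<forall>E x. eventually E u \<longrightarrow> E (x, x)) \<and>
     (\<forall>E. eventually E u \<longrightarrow> eventually (\<lambda>(x, y). E (y, x)) u) \<and>
     (\<forall>E. eventually E u \<longrightarrow>
        (\<exists>D. eventually D u \<and> (\<forall>x y z. D (x, y) \<longrightarrow> D (y, z) \<longrightarrow> E (x, z))))"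

definition prod_uniformity ::
    "('a \<times> 'a) filter \<Rightarrow> ('b \<times> 'b) filter \<Rightarrow> (('a \<times> 'b) \<times> ('a \<times> 'b)) filter" where
  "prod_uniformity u v =
     filtermap (\<lambda>((x1, x2), (y1, y2)). ((x1, y1), (x2, y2))) (u \<times>\<^sub>F v)"

definition uniformly_continuous_map ::
    "('a \<times> 'a) filter \<Rightarrow> ('b \<times> 'b) filter \<Rightarrow> ('a \<Rightarrow> 'b) \<Rightarrow> bool" where
  "uniformly_continuous_map u v f \<longleftrightarrow> (LIM (x, y) u. (f x, f y) :> v)"

definition lattice_uniformity :: "('a::lattice \<times> 'a) filter \<Rightarrow> bool" where
  "lattice_uniformity u \<longleftrightarrow>
     is_uniformity u \<and>
     uniformly_continuous_map (prod_uniformity u u) u (\<lambda>(x, y). sup x y) \<and>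
     uniformly_continuous_map (prod_uniformity u u) u (\<lambda>(x, y). inf x y)"

text \<open>
  Here \<open>v\<close> is the coarser uniformity. The order on \<^typ>\<open>'a filter\<close> is reverse inclusion of the
  systems of eventual properties, so this is the same as \<open>w \<le> v\<close>.
\<close>

definition coarser_uniformity :: "('a \<times> 'a) filter \<Rightarrow> ('a \<times> 'a) filter \<Rightarrow> bool" where
  "coarser_uniformity v w \<longleftrightarrow> (\<forall>E. eventually E v \<longrightarrow> eventually E w)"

lemma coarser_uniformity_iff_le: "coarser_uniformity v w \<longleftrightarrow> w \<le> v"
  by (simp add: coarser_uniformity_def le_filter_def)

text \<open>
  The uniformity induced on \<open>B\<close> is represented, as by \<open>uniformity_on\<close> in the library, by the filter
  on \<open>'a \<times> 'a\<close> generated by the traces of the entourages on \<open>B \<times> B\<close>.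
\<close>

definition uniformities_agree_on :: "('a \<times> 'a) filter \<Rightarrow> ('a \<times> 'a) filter \<Rightarrow> 'a set \<Rightarrow> bool" where
  "uniformities_agree_on u v B \<longleftrightarrow> inf u (principal (B \<times> B)) = inf v (principal (B \<times> B))"

lemma uniformities_agree_on_iff_traces:
  "uniformities_agree_on u v B \<longleftrightarrow>
     {{p. E p} \<inter> (B \<times> B) | E. eventually E u} = {{p. E p} \<inter> (B \<times> B) | E. eventually E v}"
proof -
  have tr: "{{p. E p} \<inter> (B \<times> B) | E. eventually E w} =
      {S. S \<subseteq> B \<times> B \<and> eventually (\<lambda>p. p \<in> S) (inf w (principal (B \<times> B)))}" for w
  proof (intro equalityI subsetI)
    fix S assume "S \<in> {{p. E p} \<inter> (B \<times> B) | E. eventually E w}"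
    then obtain E where S: "S = {p. E p} \<inter> (B \<times> B)" and E: "eventually E w"
      by blast
    from E have "eventually (\<lambda>p. p \<in> B \<times> B \<longrightarrow> p \<in> S) w"
      by (rule eventually_mono) (simp add: S)
    then show "S \<in> {S. S \<subseteq> B \<times> B \<and> eventually (\<lambda>p. p \<in> S) (inf w (principal (B \<times> B)))}"
      by (simp add: eventually_inf_principal S)
  next
    fix S assume S: "S \<in> {S. S \<subseteq> B \<times> B \<and> eventually (\<lambda>p. p \<in> S) (inf w (principal (B \<times> B)))}"
    then have "eventually (\<lambda>p. p \<in> B \<times> B \<longrightarrow> p \<in> S) w"
      by (simp only: eventually_inf_principal mem_Collect_eq)
    moreover have "S = {p. p \<in> B \<times> B \<longrightarrow> p \<in> S} \<inter> (B \<times> B)"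
      using S by blast
    ultimately show "S \<in> {{p. E p} \<inter> (B \<times> B) | E. eventually E w}"
      by blast
  qed
  have ev: "eventually E (inf w (principal (B \<times> B))) \<longleftrightarrow>
      eventually (\<lambda>p. p \<in> {p. E p} \<inter> (B \<times> B)) (inf w (principal (B \<times> B)))" for E w
  proof -
    have "(\<lambda>p. p \<in> B \<times> B \<longrightarrow> p \<in> {p. E p} \<inter> (B \<times> B)) = (\<lambda>p. p \<in> B \<times> B \<longrightarrow> E p)"
      by blast
    then show ?thesis
      by (simp only: eventually_inf_principal)
  qed
  show ?thesis
    unfolding uniformities_agree_on_def tr
  proof
    assume *: "{S. S \<subseteq> B \<times> B \<and> eventually (\<lambda>p. p \<in> S) (inf u (principal (B \<times> B)))} =
      {S. S \<subseteq> B \<times> B \<and> eventually (\<lambda>p. p \<in> S) (inf v (principal (B \<times> B)))}"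
    show "inf u (principal (B \<times> B)) = inf v (principal (B \<times> B))"
      unfolding filter_eq_iff
    proof
      fix E
      have "{p. E p} \<inter> (B \<times> B) \<subseteq> B \<times> B" by blast
      then show "eventually E (inf u (principal (B \<times> B))) \<longleftrightarrow>
          eventually E (inf v (principal (B \<times> B)))"
        using * ev[of E u] ev[of E v] by blast
    qed
  qed simp
qed

text \<open>The formula for the open sets is the one of the class \<open>open_uniformity\<close>.\<close>

definition uniformity_topology :: "('a \<times> 'a) filter \<Rightarrow> 'a topology" where
  "uniformity_topology u =
     topology (\<lambda>U. \<forall>x\<in>U. eventually (\<lambda>(x', y). x' = x \<longrightarrow> y \<in> U) u)"

lemma openin_uniformity_topology:
  "openin (uniformity_topology u) U \<longleftrightarrow>
     (\<forall>x\<in>U. eventually (\<lambda>(x', y). x' = x \<longrightarrow> y \<in> U) u)"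
proof -
  have "istopology (\<lambda>U. \<forall>x\<in>U. eventually (\<lambda>(x', y). x' = x \<longrightarrow> y \<in> U) u)"
    unfolding istopology_def
  proof (intro conjI allI impI ballI)
    fix S T x
    assume "\<forall>x\<in>S. eventually (\<lambda>(x', y). x' = x \<longrightarrow> y \<in> S) u"
      and "\<forall>x\<in>T. eventually (\<lambda>(x', y). x' = x \<longrightarrow> y \<in> T) u" and "x \<in> S \<inter> T"
    then have "eventually (\<lambda>(x', y). x' = x \<longrightarrow> y \<in> S) u"
      and "eventually (\<lambda>(x', y). x' = x \<longrightarrow> y \<in> T) u"
      by blast+
    then show "eventually (\<lambda>(x', y). x' = x \<longrightarrow> y \<in> S \<inter> T) u"
      by (rule eventually_elim2) auto
  next
    fix K x
    assume "\<forall>S\<in>K. \<forall>x\<in>S. eventually (\<lambda>(x', y). x' = x \<longrightarrow> y \<in> S) u" and "x \<in> \<Union>K"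
    then obtain S where "S \<in> K" "eventually (\<lambda>(x', y). x' = x \<longrightarrow> y \<in> S) u"
      by blast
    from this(2) show "eventually (\<lambda>(x', y). x' = x \<longrightarrow> y \<in> \<Union>K) u"
      by (rule eventually_mono) (use \<open>S \<in> K\<close> in auto)
  qed
  then show ?thesis
    by (simp add: uniformity_topology_def topology_inverse')
qed

lemma topspace_uniformity_topology [simp]: "topspace (uniformity_topology u) = UNIV"
proof -
  have "openin (uniformity_topology u) UNIV"
    by (simp add: openin_uniformity_topology split_beta')
  then show ?thesis
    using openin_subset by blast
qed

definition lattice_topology :: "'a::lattice topology \<Rightarrow> bool" where
  "lattice_topology T \<longleftrightarrow>
     topspace T = UNIV \<and>
     continuous_map (prod_topology T T) T (\<lambda>(x, y). sup x y) \<and>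
     continuous_map (prod_topology T T) T (\<lambda>(x, y). inf x y)"

definition coarser_topology :: "'a topology \<Rightarrow> 'a topology \<Rightarrow> bool" where
  "coarser_topology S T \<longleftrightarrow> (\<forall>U. openin S U \<longrightarrow> openin T U)"

definition topologies_agree_on :: "'a topology \<Rightarrow> 'a topology \<Rightarrow> 'a set \<Rightarrow> bool" where
  "topologies_agree_on S T B \<longleftrightarrow> subtopology S B = subtopology T B"

definition order_bounded :: "'a::order set \<Rightarrow> bool" where
  "order_bounded B \<longleftrightarrow> (\<exists>a b. B \<subseteq> {a..b})"

definition clamp_map :: "'a::lattice \<Rightarrow> 'a \<Rightarrow> 'a \<Rightarrow> 'a" where
  "clamp_map a b x = sup (inf x b) a"

text \<open>
  The infimum of filters is the filter generated by their union, and \<open>filtercomap g u\<close> is generated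
  by the preimages under \<open>g\<close> of the members of \<open>u\<close>; so this is the initial uniformity of the maps
  \<open>clamp_map a b\<close> with \<open>a \<le> b\<close>.
\<close>

definition star_uniformity :: "('a::lattice \<times> 'a) filter \<Rightarrow> ('a \<times> 'a) filter" where
  "star_uniformity u =
     (INF (a, b)\<in>{(a, b). a \<le> b}.
        filtercomap (\<lambda>(x, y). (clamp_map a b x, clamp_map a b y)) u)"

end

theory Submission
  imports Defs "HOL-Analysis.Abstract_Limits"
begin

text \<open>
  In a distributive lattice the maps \<^term>\<open>clamp_map a b\<close> are idempotent lattice homomorphisms, and
  \<^term>\<open>clamp_map a b\<close> retracts the lattice onto the interval from \<open>a\<close> to \<open>b\<close>. The homomorphism
  property makes the initial uniformity a lattice uniformity, and the retraction property makes it
  agree with \<open>u\<close> on intervals. If a lattice uniformity or a lattice topology agrees with \<open>u\<close> on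
  intervals, then each \<^term>\<open>clamp_map a b\<close>, being continuous into an interval, is continuous into
  \<open>u\<close>; so the initial structure is coarser.
\<close>

section \<open>Uniformities and their topologies\<close>

lemma is_uniformityD:
  assumes "is_uniformity u" "eventually E u"
  shows is_uniformity_refl: "E (x, x)"
    and is_uniformity_sym: "eventually (\<lambda>(x, y). E (y, x)) u"
    and is_uniformity_trans:
      "\<exists>D. eventually D u \<and> (\<forall>x y z. D (x, y) \<longrightarrow> D (y, z) \<longrightarrow> E (x, z))"
  using assms unfolding is_uniformity_def by blast+

section \<open>Stability of uniformities under infima and preimages\<close>

lemma is_uniformity_top: "is_uniformity top"
  unfolding is_uniformity_def by auto

lemma is_uniformity_inf:
  assumes u: "is_uniformity u" and v: "is_uniformity v"
  shows "is_uniformity (inf u v)"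
  unfolding is_uniformity_def
proof (intro conjI allI impI)
  fix E x assume "eventually E (inf u v)"
  then obtain P Q where "eventually P u" "eventually Q v" and E: "\<And>p. P p \<Longrightarrow> Q p \<Longrightarrow> E p"
    by (auto simp: eventually_inf)
  then show "E (x, x)"
    using is_uniformity_refl[OF u] is_uniformity_refl[OF v] by blast
next
  fix E assume "eventually E (inf u v)"
  then obtain P Q where "eventually P u" "eventually Q v" and E: "\<And>p. P p \<Longrightarrow> Q p \<Longrightarrow> E p"
    by (auto simp: eventually_inf)
  then have "eventually (\<lambda>(x, y). P (y, x)) u" "eventually (\<lambda>(x, y). Q (y, x)) v"
    using is_uniformity_sym u v by blast+
  then show "eventually (\<lambda>(x, y). E (y, x)) (inf u v)"
    unfolding eventually_inf by (intro exI conjI) (auto simp: E)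
next
  fix E assume "eventually E (inf u v)"
  then obtain P Q where PQ: "eventually P u" "eventually Q v"
    and E: "\<And>p. P p \<Longrightarrow> Q p \<Longrightarrow> E p"
    by (auto simp: eventually_inf)
  obtain P' where P': "eventually P' u" "\<And>x y z. P' (x, y) \<Longrightarrow> P' (y, z) \<Longrightarrow> P (x, z)"
    using is_uniformity_trans[OF u PQ(1)] by blast
  obtain Q' where Q': "eventually Q' v" "\<And>x y z. Q' (x, y) \<Longrightarrow> Q' (y, z) \<Longrightarrow> Q (x, z)"
    using is_uniformity_trans[OF v PQ(2)] by blast
  have "eventually (\<lambda>p. P' p \<and> Q' p) (inf u v)"
    using P'(1) Q'(1) unfolding eventually_inf by blast
  then show "\<exists>D. eventually D (inf u v) \<and> (\<forall>x y z. D (x, y) \<longrightarrow> D (y, z) \<longrightarrow> E (x, z))"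
    using P'(2) Q'(2) E by (intro exI[of _ "\<lambda>p. P' p \<and> Q' p"]) blast
qed

text \<open>Every axiom concerns one entourage at a time, and an entourage of the infimum is already
  one of a finite subinfimum; so the binary case suffices.\<close>

lemma is_uniformity_INF:
  assumes "\<And>i. i \<in> I \<Longrightarrow> is_uniformity (u i)"
  shows "is_uniformity (INF i\<in>I. u i)"
proof -
  have fin: "is_uniformity (INF i\<in>J. u i)" if "finite J" "J \<subseteq> I" for J
    using that
    by (induction rule: finite_induct) (auto intro: is_uniformity_top is_uniformity_inf assms)
  \<comment> \<open>Passes from the infimum to a uniformity \<open>v\<close> that lies above it in
    the filter order and has \<open>E\<close> as an entourage. The entourages that the axioms yield
    for \<open>v\<close> are then entourages of the infimum.\<close>
  have sub: thesis
    if E: "eventually E (INF i\<in>I. u i)"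
      and *: "\<And>v. \<lbrakk>is_uniformity v; eventually E v; (INF i\<in>I. u i) \<le> v\<rbrakk> \<Longrightarrow> thesis" for E thesis
  proof -
    obtain J where J: "J \<subseteq> I" "finite J" "eventually E (INF i\<in>J. u i)"
      using E unfolding eventually_INF[of _ _ I] by blast
    show thesis
      by (rule *[OF fin[OF J(2,1)] J(3)]) (rule INF_superset_mono[OF J(1) order_refl])
  qed
  show ?thesis
    unfolding is_uniformity_def
  proof (intro conjI allI impI)
    fix E x assume "eventually E (INF i\<in>I. u i)"
    then show "E (x, x)" by (rule sub) (rule is_uniformity_refl)
  next
    fix E assume "eventually E (INF i\<in>I. u i)"
    then show "eventually (\<lambda>(x, y). E (y, x)) (INF i\<in>I. u i)"
      by (rule sub) (blast intro: filter_leD is_uniformity_sym)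
  next
    fix E assume "eventually E (INF i\<in>I. u i)"
    then show "\<exists>D. eventually D (INF i\<in>I. u i) \<and> (\<forall>x y z. D (x, y) \<longrightarrow> D (y, z) \<longrightarrow> E (x, z))"
    proof (rule sub)
      fix v assume v: "is_uniformity v" "eventually E v" and le: "(INF i\<in>I. u i) \<le> v"
      obtain D where "eventually D v" "\<forall>x y z. D (x, y) \<longrightarrow> D (y, z) \<longrightarrow> E (x, z)"
        using is_uniformity_trans[OF v] by blast
      then show ?thesis
        using filter_leD[OF le] by blast
    qed
  qed
qed

lemma is_uniformity_filtercomap:
  assumes u: "is_uniformity u"
  shows "is_uniformity (filtercomap (\<lambda>(x, y). (f x, f y)) u)"
  unfolding is_uniformity_def
proof (intro conjI allI impI)
  fix E x assume "eventually E (filtercomap (\<lambda>(x, y). (f x, f y)) u)"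
  then show "E (x, x)"
    using is_uniformity_refl[OF u] by (auto simp: eventually_filtercomap)
next
  fix E assume "eventually E (filtercomap (\<lambda>(x, y). (f x, f y)) u)"
  then obtain P where P: "eventually P u" and E: "\<And>x y. P (f x, f y) \<Longrightarrow> E (x, y)"
    by (auto simp: eventually_filtercomap)
  show "eventually (\<lambda>(x, y). E (y, x)) (filtercomap (\<lambda>(x, y). (f x, f y)) u)"
    unfolding eventually_filtercomap
    by (rule exI, rule conjI, rule is_uniformity_sym[OF u P]) (auto simp: E)
next
  fix E assume "eventually E (filtercomap (\<lambda>(x, y). (f x, f y)) u)"
  then obtain P where P: "eventually P u" and E: "\<And>x y. P (f x, f y) \<Longrightarrow> E (x, y)"
    by (auto simp: eventually_filtercomap)
  obtain D where D: "eventually D u" "\<And>x y z. D (x, y) \<Longrightarrow> D (y, z) \<Longrightarrow> P (x, z)"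
    using is_uniformity_trans[OF u P] by blast
  have "eventually (\<lambda>(x, y). D (f x, f y)) (filtercomap (\<lambda>(x, y). (f x, f y)) u)"
    unfolding eventually_filtercomap using D(1) by (intro exI[of _ D]) auto
  then show "\<exists>D. eventually D (filtercomap (\<lambda>(x, y). (f x, f y)) u) \<and>
      (\<forall>x y z. D (x, y) \<longrightarrow> D (y, z) \<longrightarrow> E (x, z))"
    using D(2) E by (intro exI[of _ "\<lambda>(x, y). D (f x, f y)"]) auto
qed

section \<open>Neighbourhoods and continuity in the induced topology\<close>

text \<open>Neighbourhoods of \<open>x\<close> are the sections of entourages at \<open>x\<close>.
  The point is that such a section contains an open set around \<open>x\<close>, which follows by
  halving entourages.\<close>

lemma eventually_nhdsin_uniformity_topology:
  assumes u: "is_uniformity u"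
  shows "eventually P (nhdsin (uniformity_topology u) x) \<longleftrightarrow>
    eventually (\<lambda>(x', y). x' = x \<longrightarrow> P y) u" (is "?l \<longleftrightarrow> ?r")
proof
  assume ?l
  then obtain U where "openin (uniformity_topology u) U" "x \<in> U" "\<forall>y\<in>U. P y"
    by (auto simp: eventually_nhdsin)
  then have "eventually (\<lambda>(x', y). x' = x \<longrightarrow> y \<in> U) u"
    by (simp add: openin_uniformity_topology)
  then show ?r
    by (rule eventually_mono) (use \<open>\<forall>y\<in>U. P y\<close> in auto)
next
  \<comment> \<open>The candidate for the interior of \<open>P\<close>: all points at which some
    section of an entourage satisfies \<open>P\<close>.\<close>
  define U where "U = {z. eventually (\<lambda>(z', y). z' = z \<longrightarrow> P y) u}"
  assume ?r
  then have "x \<in> U" by (simp add: U_def)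
  moreover have "P y" if "y \<in> U" for y
    using is_uniformity_refl[OF u, of "\<lambda>(z', w). z' = y \<longrightarrow> P w" y] that by (simp add: U_def)
  moreover have "openin (uniformity_topology u) U"
    unfolding openin_uniformity_topology
  proof
    fix z assume "z \<in> U"
    then obtain D where D: "eventually D u"
      and DD: "\<And>x y w. D (x, y) \<Longrightarrow> D (y, w) \<Longrightarrow> x = z \<longrightarrow> P w"
      using is_uniformity_trans[OF u, of "\<lambda>(z', y). z' = z \<longrightarrow> P y"] unfolding U_def by auto
    \<comment> \<open>Every \<open>y\<close> that is \<open>D\<close>-close to \<open>z\<close> lies
      in \<open>U\<close> again, because its own \<open>D\<close>-section is contained in
      \<open>P\<close> by the composition property of \<open>D\<close>.\<close>
    have "eventually (\<lambda>(y', w). y' = y \<longrightarrow> P w) u" if "D (z, y)" for y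
      using D by (rule eventually_mono) (use DD that in auto)
    then show "eventually (\<lambda>(z', y). z' = z \<longrightarrow> y \<in> U) u"
      unfolding U_def using D by (auto elim!: eventually_mono)
  qed
  ultimately show ?l
    by (auto simp: eventually_nhdsin)
qed

text \<open>Turns continuity into a limit of pairs, the same shape as uniform continuity, so that
  both can be handled by composing \<open>filterlim\<close> facts.\<close>

lemma continuous_map_uniformity_topology_iff:
  assumes u: "is_uniformity u"
  shows "continuous_map T (uniformity_topology u) f \<longleftrightarrow>
    (\<forall>x\<in>topspace T. LIM y (nhdsin T x). (f x, f y) :> u)" (is "?l \<longleftrightarrow> ?r")
proof
  assume f: ?l
  show ?r
    unfolding filterlim_iff
  proof (intro ballI allI impI)
    fix x E assume x: "x \<in> topspace T" and E: "eventually E u"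
    have "eventually (\<lambda>y. E (f x, y)) (nhdsin (uniformity_topology u) (f x))"
      unfolding eventually_nhdsin_uniformity_topology[OF u]
      using E by (rule eventually_mono) auto
    then obtain V where V: "openin (uniformity_topology u) V" "f x \<in> V" "\<forall>y\<in>V. E (f x, y)"
      by (auto simp: eventually_nhdsin)
    then show "eventually (\<lambda>y. E (f x, f y)) (nhdsin T x)"
      using openin_continuous_map_preimage[OF f V(1)] x unfolding eventually_nhdsin
      by (intro disjI2 exI[of _ "{y \<in> topspace T. f y \<in> V}"]) auto
  qed
next
  assume lim: ?r
  show ?l
    unfolding continuous_map
  proof (intro conjI allI impI)
    fix U assume U: "openin (uniformity_topology u) U"
    show "openin T {x \<in> topspace T. f x \<in> U}"
    proof (subst openin_subopen, intro ballI)
      fix x assume x: "x \<in> {x \<in> topspace T. f x \<in> U}"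
      then have "eventually (\<lambda>(x', y). x' = f x \<longrightarrow> y \<in> U) u"
        using U by (simp add: openin_uniformity_topology)
      then have "eventually (\<lambda>y. f y \<in> U) (nhdsin T x)"
        using lim x unfolding filterlim_iff by fastforce
      then obtain S where S: "openin T S" "x \<in> S" "\<forall>y\<in>S. f y \<in> U"
        using x by (auto simp: eventually_nhdsin)
      then show "\<exists>S. openin T S \<and> x \<in> S \<and> S \<subseteq> {x \<in> topspace T. f x \<in> U}"
        using openin_subset by blast
    qed
  qed auto
qed

lemma continuous_map_uniformity_topology:
  assumes u: "is_uniformity u" and v: "is_uniformity v" and f: "uniformly_continuous_map u v f"
  shows "continuous_map (uniformity_topology u) (uniformity_topology v) f"
  unfolding continuous_map_uniformity_topology_iff[OF v]
proof
  fix x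
  \<comment> \<open>The criterion applied to the identity: nearby points form pairs that tend to
    \<open>u\<close>.\<close>
  have "LIM y (nhdsin (uniformity_topology u) x). (x, y) :> u"
    using continuous_map_uniformity_topology_iff[OF u, THEN iffD1, OF continuous_map_id] by simp
  from filterlim_compose[OF f[unfolded uniformly_continuous_map_def] this]
  show "LIM y (nhdsin (uniformity_topology u) x). (f x, f y) :> v"
    by simp
qed

text \<open>The two limits are paired, and the coordinates are then permuted as in the definition of
  \<open>prod_uniformity\<close>.\<close>

lemma filterlim_prod_uniformity:
  assumes "LIM z F. (f z, g z) :> u" "LIM z F. (h z, k z) :> v"
  shows "LIM z F. ((f z, h z), (g z, k z)) :> prod_uniformity u v"
  using filtermap_mono[OF filterlim_Pair[OF assms, unfolded filterlim_def],
      of "\<lambda>((x1, x2), (y1, y2)). ((x1, y1), (x2, y2))"]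
  unfolding prod_uniformity_def filterlim_def by (simp add: filtermap_filtermap)

text \<open>Continuity of the two projections makes both coordinates close, hence the points close
  in the product uniformity, to which \<open>f\<close> can be applied.\<close>

lemma continuous_map_prod_uniformity_topology:
  assumes u: "is_uniformity u" and v: "is_uniformity v" and w: "is_uniformity w"
    and f: "uniformly_continuous_map (prod_uniformity u v) w f"
  shows "continuous_map (prod_topology (uniformity_topology u) (uniformity_topology v))
    (uniformity_topology w) f"
  unfolding continuous_map_uniformity_topology_iff[OF w]
proof
  let ?T = "prod_topology (uniformity_topology u) (uniformity_topology v)"
  fix p
  have "LIM q (nhdsin ?T p). (fst p, fst q) :> u" "LIM q (nhdsin ?T p). (snd p, snd q) :> v"
    using continuous_map_uniformity_topology_iff[OF u, THEN iffD1, OF continuous_map_fst,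
        THEN bspec, of p]
      continuous_map_uniformity_topology_iff[OF v, THEN iffD1, OF continuous_map_snd,
        THEN bspec, of p]
    by simp_all
  from filterlim_compose[OF f[unfolded uniformly_continuous_map_def]
      filterlim_prod_uniformity[OF this]]
  show "LIM q (nhdsin ?T p). (f p, f q) :> w"
    by simp
qed

lemma lattice_topology_uniformity_topology:
  assumes "lattice_uniformity u"
  shows "lattice_topology (uniformity_topology u)"
  using assms continuous_map_prod_uniformity_topology[of u u u]
  unfolding lattice_uniformity_def lattice_topology_def by auto

section \<open>Clamping maps and the star uniformity\<close>

lemma clamp_map_in: "a \<le> b \<Longrightarrow> clamp_map a b x \<in> {a..b}"
  by (simp add: clamp_map_def)

lemma clamp_map_ident: "x \<in> {a..b} \<Longrightarrow> clamp_map a b x = x"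
  by (simp add: clamp_map_def inf_absorb1 sup_absorb1)

lemma clamp_map_idem: "a \<le> b \<Longrightarrow> clamp_map a b (clamp_map a b x) = clamp_map a b x"
  using clamp_map_in clamp_map_ident by blast

text \<open>Meeting with \<open>b\<close> distributes over the join, and the second copy of
  \<open>a\<close> is absorbed. Distributivity enters the argument here and in the companion
  \<open>clamp_map_inf\<close>.\<close>

lemma clamp_map_sup:
  "clamp_map a b (sup x y) = sup (clamp_map a b x) (clamp_map a b (y::'a::distrib_lattice))"
  by (simp add: clamp_map_def inf_sup_distrib2 sup.assoc sup.left_commute)

lemma clamp_map_inf:
  "clamp_map a b (inf x y) = inf (clamp_map a b x) (clamp_map a b (y::'a::distrib_lattice))"
  by (simp add: clamp_map_def sup_inf_distrib2 inf.assoc inf.left_commute)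

text \<open>Uniform continuity of the operations as introduction rules for limits of pairs; compound
  lattice terms are then handled by repeated application.\<close>

lemma filterlim_lattice_uniformity:
  assumes u: "lattice_uniformity u" and "LIM z F. (f z, g z) :> u" "LIM z F. (h z, k z) :> u"
  shows "LIM z F. (sup (f z) (h z), sup (g z) (k z)) :> u"
    and "LIM z F. (inf (f z) (h z), inf (g z) (k z)) :> u"
proof -
  note lim = filterlim_prod_uniformity[OF assms(2,3)]
  have "LIM (p, q) (prod_uniformity u u). (case p of (x, y) \<Rightarrow> sup x y, case q of (x, y) \<Rightarrow> sup x y) :> u"
    "LIM (p, q) (prod_uniformity u u). (case p of (x, y) \<Rightarrow> inf x y, case q of (x, y) \<Rightarrow> inf x y) :> u"
    using u unfolding lattice_uniformity_def uniformly_continuous_map_def by blast+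
  from filterlim_compose[OF this(1) lim] filterlim_compose[OF this(2) lim]
  show "LIM z F. (sup (f z) (h z), sup (g z) (k z)) :> u"
    "LIM z F. (inf (f z) (h z), inf (g z) (k z)) :> u"
    by simp_all
qed

lemma filterlim_clamp_map:
  assumes u: "lattice_uniformity u" and lim: "LIM z F. (f z, g z) :> u"
  shows "LIM z F. (clamp_map a b (f z), clamp_map a b (g z)) :> u"
proof -
  \<comment> \<open>Entourages contain the diagonal, so the constants \<open>a\<close> and
    \<open>b\<close> in the clamping term cause no variation.\<close>
  have const: "LIM z F. (c, c) :> u" for c
    using u is_uniformity_refl unfolding lattice_uniformity_def filterlim_iff by fastforce
  show ?thesis
    unfolding clamp_map_def by (intro filterlim_lattice_uniformity[OF u] lim const)
qed

lemma uniformly_continuous_clamp_map: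
  assumes "lattice_uniformity u"
  shows "uniformly_continuous_map u u (clamp_map a b)"
  using filterlim_clamp_map[OF assms, of fst snd u a b]
  by (simp add: uniformly_continuous_map_def split_beta' filterlim_ident)

section \<open>The star uniformity as an initial structure\<close>

text \<open>The universal property of an initial uniformity, through which all later facts about
  \<open>star_uniformity\<close> are obtained.\<close>

lemma filterlim_star_uniformity_iff:
  "(LIM z F. (f z, g z) :> star_uniformity u) \<longleftrightarrow>
    (\<forall>a b. a \<le> b \<longrightarrow> (LIM z F. (clamp_map a b (f z), clamp_map a b (g z)) :> u))"
  unfolding star_uniformity_def
  by (auto simp: filterlim_INF filterlim_filtercomap_iff o_def)

lemma le_star_uniformity_iff:
  "v \<le> star_uniformity u \<longleftrightarrow> (\<forall>a b. a \<le> b \<longrightarrow> uniformly_continuous_map v u (clamp_map a b))"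
  using filterlim_star_uniformity_iff[of fst snd u v]
  by (simp add: filterlim_def uniformly_continuous_map_def split_beta')

lemma uniformly_continuous_clamp_map_star:
  "a \<le> b \<Longrightarrow> uniformly_continuous_map (star_uniformity u) u (clamp_map a b)"
  using le_star_uniformity_iff by blast

text \<open>The clamping maps are uniformly continuous from \<open>u\<close> to \<open>u\<close>,
  and \<open>star_uniformity u\<close> is the coarsest filter that makes them so into
  \<open>u\<close>.\<close>

lemma le_star_uniformity: "lattice_uniformity u \<Longrightarrow> u \<le> star_uniformity u"
  by (simp add: le_star_uniformity_iff uniformly_continuous_clamp_map)

text \<open>By the universal property it suffices to clamp the result of an operation. The
  homomorphism property moves the clamp to the arguments, where closeness in the star uniformity
  gives closeness in \<open>u\<close>.\<close>

lemma lattice_uniformity_star_uniformity: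
  fixes u :: "('a::distrib_lattice \<times> 'a) filter"
  assumes u: "lattice_uniformity u"
  shows "lattice_uniformity (star_uniformity u)"
proof -
  let ?s = "star_uniformity u"
  have "is_uniformity u" using u by (simp add: lattice_uniformity_def)
  then have "is_uniformity ?s"
    unfolding star_uniformity_def by (auto intro!: is_uniformity_INF is_uniformity_filtercomap)
  \<comment> \<open>Here \<open>fst z\<close> and \<open>snd z\<close> are the two points of the
    product being compared, and each of them is a pair of arguments.\<close>
  moreover have "LIM z (prod_uniformity ?s ?s).
        (clamp_map a b (sup (fst (fst z)) (snd (fst z))),
         clamp_map a b (sup (fst (snd z)) (snd (snd z)))) :> u"
      (is ?sup)
    and "LIM z (prod_uniformity ?s ?s).
        (clamp_map a b (inf (fst (fst z)) (snd (fst z))),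
         clamp_map a b (inf (fst (snd z)) (snd (snd z)))) :> u"
      (is ?inf)
    if "a \<le> b" for a b
  proof -
    have "LIM z (prod_uniformity ?s ?s).
        (clamp_map a b (fst (fst z)), clamp_map a b (fst (snd z))) :> u"
      "LIM z (prod_uniformity ?s ?s).
        (clamp_map a b (snd (fst z)), clamp_map a b (snd (snd z))) :> u"
      using filterlim_compose[OF uniformly_continuous_clamp_map_star[OF that, of u,
            unfolded uniformly_continuous_map_def] filterlim_fst]
        filterlim_compose[OF uniformly_continuous_clamp_map_star[OF that, of u,
            unfolded uniformly_continuous_map_def] filterlim_snd]
      by (simp_all add: prod_uniformity_def filterlim_filtermap split_beta')
    from filterlim_lattice_uniformity[OF u this] show ?sup ?inf
      by (simp_all only: clamp_map_sup clamp_map_inf)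
  qed
  ultimately show ?thesis
    unfolding lattice_uniformity_def uniformly_continuous_map_def split_beta'
      filterlim_star_uniformity_iff by (intro conjI allI impI)
qed

text \<open>For one inequality, unfolding the star twice clamps twice with the same bounds, which is
  clamping once. For the other, the codomain \<open>u\<close> of the clamping maps is weakened to
  the coarser \<open>star_uniformity u\<close>.\<close>

lemma star_uniformity_idem:
  assumes u: "lattice_uniformity u"
  shows "star_uniformity (star_uniformity u) = star_uniformity u"
proof (rule antisym)
  show "star_uniformity (star_uniformity u) \<le> star_uniformity u"
    unfolding le_star_uniformity_iff
  proof (intro allI impI)
    fix a b :: 'a assume ab: "a \<le> b"
    have "LIM (x, y) star_uniformity (star_uniformity u).
        (clamp_map a b (clamp_map a b x), clamp_map a b (clamp_map a b y)) :> u"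
      using uniformly_continuous_clamp_map_star[OF ab, of "star_uniformity u"] ab
      unfolding uniformly_continuous_map_def split_beta' filterlim_star_uniformity_iff by blast
    then show "uniformly_continuous_map (star_uniformity (star_uniformity u)) u (clamp_map a b)"
      by (simp add: uniformly_continuous_map_def clamp_map_idem[OF ab])
  qed
next
  show "star_uniformity u \<le> star_uniformity (star_uniformity u)"
    unfolding le_star_uniformity_iff uniformly_continuous_map_def
    using uniformly_continuous_clamp_map_star[of _ _ u, unfolded uniformly_continuous_map_def]
    by (intro allI impI filterlim_mono[OF _ le_star_uniformity[OF u] order_refl])
qed

section \<open>Agreement and minimality for uniformities\<close>

lemma uniformities_agree_on_mono:
  assumes "uniformities_agree_on u v C" "B \<subseteq> C"
  shows "uniformities_agree_on u v B"
proof -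
  have "inf w (principal (B \<times> B)) = inf (inf w (principal (C \<times> C))) (principal (B \<times> B))" for w
    using assms(2) by (simp add: inf.assoc inf_principal Int_absorb1 Sigma_mono)
  then show ?thesis
    using assms(1) unfolding uniformities_agree_on_def by metis
qed

text \<open>On an interval the clamping map is the identity, so its uniform continuity into
  \<open>u\<close> says that the trace of the star uniformity is at least as fine as
  \<open>u\<close>.\<close>

lemma star_uniformity_agrees:
  assumes u: "lattice_uniformity u" and "order_bounded B"
  shows "uniformities_agree_on (star_uniformity u) u B"
\<comment> \<open>A point of \<open>B\<close> yields \<open>a \<le> b\<close>, without which the
  clamping map of the interval is not in the defining family.\<close>
proof (cases "B = {}")
  case False
  then obtain a b where B: "B \<subseteq> {a..b}" and ab: "a \<le> b"
    using assms(2) unfolding order_bounded_def by fastforce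
  let ?P = "principal ({a..b} \<times> {a..b})"
  have "inf (star_uniformity u) ?P \<le> u"
  proof -
    have lim: "LIM (x, y) (inf (star_uniformity u) ?P). (clamp_map a b x, clamp_map a b y) :> u"
      using uniformly_continuous_clamp_map_star[OF ab, of u] unfolding uniformly_continuous_map_def
      by (rule filterlim_mono) auto
    have ev: "eventually (\<lambda>p. (case p of (x, y) \<Rightarrow> (clamp_map a b x, clamp_map a b y)) = p)
        (inf (star_uniformity u) ?P)"
      unfolding eventually_inf_principal
      by (rule always_eventually) (auto simp: clamp_map_ident)
    have "LIM p (inf (star_uniformity u) ?P). p :> u"
      by (rule iffD1[OF filterlim_cong[OF refl refl ev] lim])
    then show ?thesis by (simp add: filterlim_def)
  qed
  then have "uniformities_agree_on (star_uniformity u) u {a..b}"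
    unfolding uniformities_agree_on_def using le_star_uniformity[OF u]
    by (intro antisym) (auto intro: le_infI1)
  then show ?thesis
    using B uniformities_agree_on_mono by blast
qed (simp add: uniformities_agree_on_def)

text \<open>Clamping is uniformly continuous from \<open>v\<close> to \<open>v\<close> with values
  in an interval. There \<open>v\<close> may be exchanged for \<open>u\<close>, and the universal
  property applies.\<close>

lemma le_star_uniformity_if_agree:
  assumes v: "lattice_uniformity v"
    and agree: "\<And>a b. uniformities_agree_on v u {a..b}"
  shows "v \<le> star_uniformity u"
  unfolding le_star_uniformity_iff uniformly_continuous_map_def
proof (intro allI impI)
  fix a b :: 'a assume "a \<le> b"
  let ?P = "principal ({a..b} \<times> {a..b})"
  have "LIM (x, y) v. (clamp_map a b x, clamp_map a b y) :> ?P"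
    unfolding filterlim_principal
    using clamp_map_in[OF \<open>a \<le> b\<close>] by (intro always_eventually) auto
  then have "LIM (x, y) v. (clamp_map a b x, clamp_map a b y) :> inf v ?P"
    using uniformly_continuous_clamp_map[OF v] unfolding uniformly_continuous_map_def
    by (simp add: filterlim_inf)
  then show "LIM (x, y) v. (clamp_map a b x, clamp_map a b y) :> u"
    using agree[of a b] unfolding uniformities_agree_on_def by (simp add: filterlim_inf)
qed

section \<open>Agreement and minimality for topologies\<close>

lemma continuous_map_clamp_map_star:
  assumes u: "lattice_uniformity (u :: ('a::distrib_lattice \<times> 'a) filter)" and "a \<le> b"
  shows "continuous_map (uniformity_topology (star_uniformity u)) (uniformity_topology u)
    (clamp_map a b)"
  using u lattice_uniformity_star_uniformity[OF u]
    uniformly_continuous_clamp_map_star[OF \<open>a \<le> b\<close>]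
  unfolding lattice_uniformity_def by (blast intro: continuous_map_uniformity_topology)

lemma star_topology_agrees:
  assumes u: "lattice_uniformity (u :: ('a::distrib_lattice \<times> 'a) filter)"
    and "order_bounded B"
  shows "topologies_agree_on (uniformity_topology (star_uniformity u)) (uniformity_topology u) B"
proof (cases "B = {}")
  case False
  then obtain a b where B: "B \<subseteq> {a..b}" and ab: "a \<le> b"
    using assms(2) unfolding order_bounded_def by fastforce
  have coarser: "openin (uniformity_topology u) U"
    if "openin (uniformity_topology (star_uniformity u)) U" for U
    using that le_star_uniformity[OF u] filter_leD unfolding openin_uniformity_topology by blast
  \<comment> \<open>The witness is the preimage of \<open>U\<close> under the clamping map; this map
    fixes the points of \<open>B\<close>, so the traces on \<open>B\<close> coincide.\<close>
  have trace: "\<exists>V. openin (uniformity_topology (star_uniformity u)) V \<and> U \<inter> B = V \<inter> B"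
    if "openin (uniformity_topology u) U" for U
    using openin_continuous_map_preimage[OF continuous_map_clamp_map_star[OF u ab] that] B
      clamp_map_ident[of _ a b]
    by (intro exI[of _ "{x. clamp_map a b x \<in> U}"]) auto
  show ?thesis
    unfolding topologies_agree_on_def topology_eq openin_subtopology
  proof (intro allI iffI)
    fix W assume "\<exists>U. openin (uniformity_topology (star_uniformity u)) U \<and> W = U \<inter> B"
    then show "\<exists>U. openin (uniformity_topology u) U \<and> W = U \<inter> B"
      using coarser by blast
  next
    fix W assume "\<exists>U. openin (uniformity_topology u) U \<and> W = U \<inter> B"
    then obtain U where "openin (uniformity_topology u) U" "W = U \<inter> B"
      by blast
    then show "\<exists>U. openin (uniformity_topology (star_uniformity u)) U \<and> W = U \<inter> B"
      using trace[of U] by simp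
  qed
qed (simp add: topologies_agree_on_def)

lemma continuous_map_clamp_map:
  assumes "lattice_topology T"
  shows "continuous_map T T (clamp_map a b)"
proof -
  have T: "topspace T = UNIV"
    and sup: "continuous_map (prod_topology T T) T (\<lambda>(x, y). sup x y)"
    and inf: "continuous_map (prod_topology T T) T (\<lambda>(x, y). inf x y)"
    using assms by (simp_all add: lattice_topology_def)
  have "continuous_map T (prod_topology T T) (\<lambda>x. (x, b))"
    by (intro continuous_map_pairedI) (simp_all add: T)
  from continuous_map_compose[OF this inf] have "continuous_map T T (\<lambda>x. inf x b)"
    by (simp add: o_def)
  then have "continuous_map T (prod_topology T T) (\<lambda>x. (inf x b, a))"
    by (intro continuous_map_pairedI) (simp_all add: T)
  from continuous_map_compose[OF this sup] show ?thesis
    by (simp add: o_def clamp_map_def[abs_def])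
qed

text \<open>The topological counterpart of \<open>le_star_uniformity_if_agree\<close>: clamping is
  continuous into the subtopology of an interval, where \<open>T\<close> may be exchanged for the
  topology of \<open>u\<close>.\<close>

lemma continuous_map_star_topology_if_agree:
  assumes u: "lattice_uniformity (u :: ('a::distrib_lattice \<times> 'a) filter)"
    and T: "lattice_topology T"
    and agree: "\<And>a b. topologies_agree_on T (uniformity_topology u) {a..b}"
  shows "continuous_map T (uniformity_topology (star_uniformity u)) (\<lambda>x. x)"
proof -
  have unif: "is_uniformity u" "is_uniformity (star_uniformity u)"
    using u lattice_uniformity_star_uniformity[OF u] by (simp_all add: lattice_uniformity_def)
  have "continuous_map T (uniformity_topology u) (clamp_map a b)" if "a \<le> b" for a b
  proof -
    have "continuous_map T (subtopology T {a..b}) (clamp_map a b)"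
      using continuous_map_clamp_map[OF T] clamp_map_in[OF that]
      by (auto simp: continuous_map_in_subtopology)
    then show ?thesis
      using agree[of a b] unfolding topologies_agree_on_def
      by (metis continuous_map_into_fulltopology)
  qed
  \<comment> \<open>Continuity is read as limits of pairs at each point; the universal property then
    assembles the clamped limits into one limit in the star uniformity.\<close>
  then show ?thesis
    by (simp add: continuous_map_uniformity_topology_iff unif filterlim_star_uniformity_iff)
qed

lemma order_bounded_atLeastAtMost: "order_bounded {a..b}"
  unfolding order_bounded_def by blast

theorem corollary4p3:
  fixes u :: "('a::distrib_lattice \<times> 'a) filter"
  assumes "lattice_uniformity u"
  shows "star_uniformity (star_uniformity u) = star_uniformity u \<and>
        (lattice_uniformity (star_uniformity u) \<and>
         (\<forall>B. order_bounded B \<longrightarrow> uniformities_agree_on (star_uniformity u) u B) \<and>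
         (\<forall>v. lattice_uniformity v \<and>
              (\<forall>B. order_bounded B \<longrightarrow> uniformities_agree_on v u B)
            \<longrightarrow> coarser_uniformity (star_uniformity u) v)) \<and>
        (lattice_topology (uniformity_topology (star_uniformity u)) \<and>
         (\<forall>B. order_bounded B \<longrightarrow>
              topologies_agree_on (uniformity_topology (star_uniformity u))
                (uniformity_topology u) B) \<and>
         (\<forall>T. lattice_topology T \<and>
              (\<forall>B. order_bounded B \<longrightarrow> topologies_agree_on T (uniformity_topology u) B)
            \<longrightarrow> coarser_topology (uniformity_topology (star_uniformity u)) T))"
proof -
  note u = assms
  have "coarser_uniformity (star_uniformity u) v"
    if "lattice_uniformity v" "\<forall>B. order_bounded B \<longrightarrow> uniformities_agree_on v u B" for v
    unfolding coarser_uniformity_iff_le using that order_bounded_atLeastAtMost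
    by (blast intro: le_star_uniformity_if_agree)
  moreover have "coarser_topology (uniformity_topology (star_uniformity u)) T"
    if T: "lattice_topology T"
      and agree: "\<forall>B. order_bounded B \<longrightarrow> topologies_agree_on T (uniformity_topology u) B" for T
    unfolding coarser_topology_def
  proof (intro allI impI)
    fix U assume "openin (uniformity_topology (star_uniformity u)) U"
    \<comment> \<open>Continuity of the identity is the comparison of the two topologies; intervals
      are the only bounded sets to which agreement is applied.\<close>
    moreover have "continuous_map T (uniformity_topology (star_uniformity u)) (\<lambda>x. x)"
      using agree order_bounded_atLeastAtMost
      by (blast intro: continuous_map_star_topology_if_agree[OF u T])
    ultimately have "openin T {x \<in> topspace T. x \<in> U}"
      by (rule openin_continuous_map_preimage[rotated])
    then show "openin T U"
      using T by (simp add: lattice_topology_def)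
  qed
  ultimately show ?thesis
    by (simp add: u star_uniformity_idem lattice_uniformity_star_uniformity
        star_uniformity_agrees star_topology_agrees lattice_topology_uniformity_topology)
qed

end
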